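(* Let $\mathcal{F}$ be a field with $q$ elements, where $q>3$ is odd, and let $\mathcal{S}=\mathrm{SL}(2,\mathcal{F})$. (i) Assume that $q\equiv 1 \pmod 4$. Let $w$ be a non-square element of $\mathcal{F}$, and let $A=\begin{pmatrix}1&1\\0&1\end{pmatrix}$ and $B=\begin{pmatrix}1&w\\0&1\end{pmatrix}$. Then $\eta(A^{\mathcal{S}}B^{\mathcal{S}})=\frac{q+3}{2}$. (ii) Assume that $q\not\equiv 1\pmod 4$. Let $E=\begin{pmatrix}1&1\\0&1\end{pmatrix}$. Then $\eta(E^{\mathcal{S}}E^{\mathcal{S}})=\frac{q+3}{2}$. Hence the lower bound $\frac{q+3}{2}$ for the number of conjugacy classes in the product of two noncentral conjugacy classes of $\mathrm{SL}(2,q)$, $q>3$ odd, is optimal: for every such $q$ there are noncentral matrices in $\mathrm{SL}(2,q)$ such that the product of their conjugacy classes is the union of exactly $\frac{q+3}{2}$ distinct conjugacy classes.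
   Context: $\mathrm{SL}(2,\mathcal{F})$ is the group of $2\times 2$ matrices of determinant $1$ over $\mathcal{F}$; $\mathrm{SL}(2,q)$ denotes this group when $\mathcal{F}$ has $q$ elements. For a finite group $\mathcal{G}$ and $A\in\mathcal{G}$, $A^{\mathcal{G}}=\{B^{-1}AB\mid B\in\mathcal{G}\}$ is the conjugacy class of $A$. The product of two classes is $A^{\mathcal{G}}B^{\mathcal{G}}=\{XY\mid X\in A^{\mathcal{G}},\,Y\in B^{\mathcal{G}}\}$, which is a union of conjugacy classes. For a conjugation-invariant subset $\mathcal{X}$ of $\mathcal{G}$, $\eta(\mathcal{X})$ denotes the number of distinct conjugacy classes of $\mathcal{G}$ whose union is $\mathcal{X}$. A non-square element of $\mathcal{F}$ is an element of $\mathcal{F}\setminus\{x^2\mid x\in\mathcal{F}\}$. *)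

theory Defs
  imports "HOL-Analysis.Analysis" "HOL-Algebra.Coset"
begin

definition conj_class :: "('g, 'm) monoid_scheme \<Rightarrow> 'g \<Rightarrow> 'g set" where
  "conj_class G A = {inv\<^bsub>G\<^esub> B \<otimes>\<^bsub>G\<^esub> A \<otimes>\<^bsub>G\<^esub> B |B. B \<in> carrier G}"

definition conj_classes :: "('g, 'm) monoid_scheme \<Rightarrow> 'g set set" where
  "conj_classes G = conj_class G ` carrier G"

definition group_center :: "('g, 'm) monoid_scheme \<Rightarrow> 'g set" where
  "group_center G = {z \<in> carrier G. \<forall>g \<in> carrier G. z \<otimes>\<^bsub>G\<^esub> g = g \<otimes>\<^bsub>G\<^esub> z}"

text \<open>The definite description below is meaningful only for a conjugation-invariant \<open>X\<close>, i.e. a union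
  of conjugacy classes; for such \<open>X\<close> the family is unique by lemma \<open>eta_Union\<close>.\<close>

definition eta :: "('g, 'm) monoid_scheme \<Rightarrow> 'g set \<Rightarrow> nat" where
  "eta G X = card (THE K. K \<subseteq> conj_classes G \<and> \<Union>K = X)"

definition SL2 :: "('a::field ^ 2 ^ 2) monoid" where
  "SL2 = \<lparr>carrier = {A. det A = 1}, mult = (**), one = mat 1\<rparr>"

text \<open>\<open>vector\<close> lists the rows, so this is the matrix with rows \<open>(1, t)\<close> and \<open>(0, 1)\<close>.\<close>

definition upper_unitri :: "'a::field \<Rightarrow> 'a ^ 2 ^ 2" where
  "upper_unitri t = vector [vector [1, t], vector [0, 1]]"

lemma group_SL2: "group (SL2 :: ('a::field ^ 2 ^ 2) monoid)"
proof (rule groupI)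
  fix A :: "'a ^ 2 ^ 2"
  assume "A \<in> carrier SL2"
  then have d: "det A = 1" by (simp add: SL2_def)
  then have "invertible A" by (simp add: invertible_det_nz)
  then obtain B where AB: "A ** B = mat 1" and BA: "B ** A = mat 1"
    unfolding invertible_def by blast
  have "det B * det A = 1" using BA by (metis det_I det_mul)
  then have "det B = 1" using d by simp
  then show "\<exists>B \<in> carrier SL2. B \<otimes>\<^bsub>SL2\<^esub> A = \<one>\<^bsub>SL2\<^esub>"
    using BA by (auto simp: SL2_def)
qed (auto simp: SL2_def det_mul matrix_mul_assoc)

lemma upper_unitri_in_SL2: "upper_unitri t \<in> carrier SL2"
  by (simp add: upper_unitri_def SL2_def det_2)

lemma conj_class_eqI:
  assumes "group G" "A \<in> carrier G" "X \<in> conj_class G A"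
  shows "conj_class G X = conj_class G A"
proof -
  interpret group G by fact
  obtain B where B: "B \<in> carrier G" and X: "X = inv\<^bsub>G\<^esub> B \<otimes>\<^bsub>G\<^esub> A \<otimes>\<^bsub>G\<^esub> B"
    using assms(3) by (auto simp: conj_class_def)
  have 1: "inv\<^bsub>G\<^esub> C \<otimes>\<^bsub>G\<^esub> X \<otimes>\<^bsub>G\<^esub> C = inv\<^bsub>G\<^esub> (B \<otimes>\<^bsub>G\<^esub> C) \<otimes>\<^bsub>G\<^esub> A \<otimes>\<^bsub>G\<^esub> (B \<otimes>\<^bsub>G\<^esub> C)"
    if "C \<in> carrier G" for C
    using that B assms(2) by (simp add: X inv_mult_group m_assoc)
  have 2: "inv\<^bsub>G\<^esub> C \<otimes>\<^bsub>G\<^esub> A \<otimes>\<^bsub>G\<^esub> C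
      = inv\<^bsub>G\<^esub> (inv\<^bsub>G\<^esub> B \<otimes>\<^bsub>G\<^esub> C) \<otimes>\<^bsub>G\<^esub> X \<otimes>\<^bsub>G\<^esub> (inv\<^bsub>G\<^esub> B \<otimes>\<^bsub>G\<^esub> C)"
    if "C \<in> carrier G" for C
  proof -
    have "B \<otimes>\<^bsub>G\<^esub> (inv\<^bsub>G\<^esub> B \<otimes>\<^bsub>G\<^esub> C) = C"
      using that B by (simp add: m_assoc [symmetric])
    then show ?thesis using that B 1[of "inv\<^bsub>G\<^esub> B \<otimes>\<^bsub>G\<^esub> C"] by simp
  qed
  show ?thesis
  proof (intro equalityI subsetI)
    fix Y assume "Y \<in> conj_class G X"
    then obtain C where "C \<in> carrier G" "Y = inv\<^bsub>G\<^esub> C \<otimes>\<^bsub>G\<^esub> X \<otimes>\<^bsub>G\<^esub> C"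
      by (auto simp: conj_class_def)
    then show "Y \<in> conj_class G A"
      unfolding conj_class_def using 1 B by (intro CollectI exI[of _ "B \<otimes>\<^bsub>G\<^esub> C"]) simp
  next
    fix Y assume "Y \<in> conj_class G A"
    then obtain C where "C \<in> carrier G" "Y = inv\<^bsub>G\<^esub> C \<otimes>\<^bsub>G\<^esub> A \<otimes>\<^bsub>G\<^esub> C"
      by (auto simp: conj_class_def)
    then show "Y \<in> conj_class G X"
      unfolding conj_class_def using 2 B
      by (intro CollectI exI[of _ "inv\<^bsub>G\<^esub> B \<otimes>\<^bsub>G\<^esub> C"]) (metis inv_closed m_closed)
  qed
qed

lemma eta_Union:
  assumes "group G" "K \<subseteq> conj_classes G"
  shows "eta G (\<Union>K) = card K"
proof -
  interpret group G by fact
  have self: "A \<in> conj_class G A" if "A \<in> carrier G" for A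
    unfolding conj_class_def using that by (auto intro!: exI[of _ "\<one>\<^bsub>G\<^esub>"])
  have sub: "L \<subseteq> M"
    if "L \<subseteq> conj_classes G" "M \<subseteq> conj_classes G" "\<Union>L = \<Union>M" for L M
  proof
    fix C assume "C \<in> L"
    then obtain A where A: "A \<in> carrier G" "C = conj_class G A"
      using \<open>L \<subseteq> conj_classes G\<close> by (auto simp: conj_classes_def)
    then have "A \<in> \<Union>M" using self \<open>C \<in> L\<close> \<open>\<Union>L = \<Union>M\<close> by blast
    then obtain D where "D \<in> M" "A \<in> D" by blast
    moreover from this obtain A' where "A' \<in> carrier G" "D = conj_class G A'"
      using \<open>M \<subseteq> conj_classes G\<close> by (auto simp: conj_classes_def)
    ultimately show "C \<in> M" using A conj_class_eqI[OF \<open>group G\<close>] by metis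
  qed
  have "(THE L. L \<subseteq> conj_classes G \<and> \<Union>L = \<Union>K) = K"
  proof (rule the_equality)
    show "K \<subseteq> conj_classes G \<and> \<Union>K = \<Union>K" using assms(2) by simp
    show "L = K" if "L \<subseteq> conj_classes G \<and> \<Union>L = \<Union>K" for L
      using sub[of L K] sub[of K L] that assms(2) by (simp add: subset_antisym)
  qed
  then show ?thesis by (simp add: eta_def)
qed

end

theory Submission
  imports Defs "HOL-Library.Z2"
begin

text \<open>
  Write \<open>U(t)\<close> for \<open>upper_unitri t\<close>. The two parts are instances of one fact: if \<open>w\<close> is
  nonzero and \<open>- w\<close> is not a square, then the product of the classes of \<open>U(1)\<close> and \<open>U(w)\<close> consists
  of \<open>(q + 3) / 2\<close> classes. For \<open>q \<equiv> 1\<close> modulo 4, \<open>- 1\<close> is a square, so \<open>- w\<close> is a non-square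
  whenever \<open>w\<close> is; otherwise \<open>- 1\<close> is a non-square and \<open>w = 1\<close> is admissible.

  Up to simultaneous conjugation, an element of the product of the classes of \<open>A\<close> and \<open>B\<close> has the
  form \<open>A Y\<close> with \<open>Y\<close> in the class of \<open>B\<close> (\<open>set_mult_conj_class\<close>). The conjugates of \<open>U(w)\<close> are
  explicit matrices depending on the second row \<open>(c, d)\<close> of the conjugating matrix
  (\<open>conj_class_upper_unitri\<close>), and \<open>U(1) Y\<close> then has lower left entry \<open>- w c\<^sup>2\<close> and trace
  \<open>2 - w c\<^sup>2\<close>.

  If \<open>c \<noteq> 0\<close>, a conjugation by an upper unitriangular matrix brings \<open>U(1) Y\<close> to a companion form
  determined by its lower left entry and its trace, that is, by \<open>c\<^sup>2\<close>. Different values of \<open>c\<^sup>2\<close> give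
  different traces, so these are \<open>(q - 1) / 2\<close> classes, none of trace 2.

  If \<open>c = 0\<close>, the product is \<open>U(1 + w d\<^sup>2)\<close> with \<open>d \<noteq> 0\<close>. The entry \<open>1 + w d\<^sup>2\<close> does not vanish
  because \<open>- w\<close> is not a square, and the class of \<open>U(t)\<close> for \<open>t \<noteq> 0\<close> depends only on whether \<open>t\<close>
  is a square. Both possibilities occur: non-squares because \<open>- 1 / w\<close> is a sum of two squares, squares
  by the rational parametrization of the conic \<open>y\<^sup>2 = 1 + w d\<^sup>2\<close>; the latter needs
  \<open>q > 3\<close>. This adds two classes, \<open>(q + 3) / 2\<close> in total.
\<close>

section \<open>Squares in a finite field of odd order\<close>

text \<open>Summing the constant 1 over the set in the two-element field detects the parity of its size, and
  the summands cancel along the orbits of the involution.\<close>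

lemma even_card_if_free_involution:
  assumes "\<And>x. x \<in> X \<Longrightarrow> h x \<in> X" "\<And>x. x \<in> X \<Longrightarrow> h (h x) = x" "\<And>x. x \<in> X \<Longrightarrow> h x \<noteq> x"
  shows "even (card X)"
proof -
  have "(\<Sum>x\<in>X. 1 :: bit) = 0"
    by (rule sum_involution_eq_0[of X "\<lambda>_. 1" h]) (use assms in auto)
  then have "of_nat (card X) = (0 :: bit)" by simp
  then show ?thesis by (metis even_of_nat_iff dvd_0_right)
qed

text \<open>If \<open>2 = 0\<close>, then adding 1 is a fixed-point-free involution of the field.\<close>

lemma two_neq_zero_if_odd_card:
  assumes "odd CARD('a::{field,finite})"
  shows "(2::'a) \<noteq> 0"
proof
  assume "(2::'a) = 0"
  then have "x + 1 + 1 = x" for x :: 'a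
    by (simp add: add.assoc)
  then have "even CARD('a)"
    by (intro even_card_if_free_involution[of UNIV "\<lambda>x. x + 1"]) auto
  then show False using assms by simp
qed

definition nonzero_squares :: "'a::field set" where
  "nonzero_squares = (\<lambda>x. x\<^sup>2) ` (UNIV - {0})"

lemma zero_notin_nonzero_squares [simp]: "0 \<notin> nonzero_squares"
  by (auto simp: nonzero_squares_def)

lemma power2_in_nonzero_squares [simp]: "x\<^sup>2 \<in> nonzero_squares \<longleftrightarrow> x \<noteq> 0" for x :: "'a::field"
  by (auto simp: nonzero_squares_def)

lemma nonzero_squaresE:
  assumes "s \<in> nonzero_squares"
  obtains d :: "'a::field" where "d \<noteq> 0" "s = d\<^sup>2"
  using assms by (auto simp: nonzero_squares_def)

lemma nonzero_squares_if_mult_square: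
  fixes n a b :: "'a::field"
  assumes "n * b\<^sup>2 = a\<^sup>2" "a \<noteq> 0" "b \<noteq> 0"
  shows "n \<in> nonzero_squares"
proof -
  have "n = (a / b)\<^sup>2" using assms by (simp add: power_divide eq_divide_eq)
  then show ?thesis using assms(2,3) by simp
qed

lemma minus_neq_self:
  assumes "(2::'a::field) \<noteq> 0" "x \<noteq> 0"
  shows "- x \<noteq> (x :: 'a)"
proof
  assume "- x = x"
  then have "2 * x = 0" by (metis add.right_inverse mult_2)
  with assms show False by simp
qed

lemma card_nonzero_squares:
  assumes "(2::'a::{field,finite}) \<noteq> 0"
  shows "2 * card (nonzero_squares :: 'a set) + 1 = CARD('a)"
proof -
  have "card (UNIV - {0::'a}) = (\<Sum>x\<in>UNIV - {0::'a}. 1)" by simp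
  also have "\<dots> = (\<Sum>s\<in>nonzero_squares. \<Sum>x\<in>{x\<in>UNIV - {0::'a}. x\<^sup>2 = s}. 1)"
    unfolding nonzero_squares_def by (rule sum.image_gen) simp
  also have "\<dots> = (\<Sum>s\<in>(nonzero_squares :: 'a set). 2)"
  proof (rule sum.cong[OF refl])
    fix s :: 'a assume "s \<in> nonzero_squares"
    then obtain d where d: "d \<noteq> 0" "s = d\<^sup>2" by (rule nonzero_squaresE)
    then have "{x\<in>UNIV - {0::'a}. x\<^sup>2 = s} = {d, - d}"
      by (auto simp: power2_eq_iff)
    moreover have "d \<noteq> - d" using minus_neq_self[OF assms d(1)] by metis
    ultimately show "(\<Sum>x\<in>{x\<in>UNIV - {0::'a}. x\<^sup>2 = s}. 1) = (2::nat)" by simp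
  qed
  finally have "card (UNIV - {0::'a}) = 2 * card (nonzero_squares :: 'a set)" by simp
  then show ?thesis
    using card_Suc_Diff1[of "UNIV :: 'a set" 0] by simp
qed

text \<open>Inversion acts on the nonzero squares, and its possible fixed points are \<open>1\<close> and \<open>- 1\<close>. The other
  squares pair off, so the parity of the number of squares tells whether \<open>- 1\<close> is among them. This
  gives both directions of the criterion for \<open>- 1\<close> to be a square without a generator of the
  multiplicative group.\<close>

lemma minus_one_square_iff:
  assumes "(2::'a::{field,finite}) \<noteq> 0"
  shows "(- 1 :: 'a) \<in> nonzero_squares \<longleftrightarrow> even (card (nonzero_squares :: 'a set))"
proof -
  let ?S = "nonzero_squares :: 'a set"
  have "even (card (?S - {1, - 1}))"
  proof (rule even_card_if_free_involution[where h = inverse])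
    fix x assume x: "x \<in> ?S - {1, - 1}"
    then obtain d where d: "d \<noteq> 0" "x = d\<^sup>2" by (auto elim: nonzero_squaresE)
    then have "inverse x = (inverse d)\<^sup>2" by (simp add: power_inverse)
    moreover have "inverse x \<noteq> 1" "inverse x \<noteq> - 1"
      using x by (metis DiffD2 insertCI inverse_1 inverse_inverse_eq inverse_minus_eq)+
    ultimately show "inverse x \<in> ?S - {1, - 1}" using d by simp
    show "inverse x \<noteq> x"
    proof
      assume "inverse x = x"
      then have "x * x = 1" using d by (metis power_not_zero right_inverse)
      then show False using x by (simp add: square_eq_1_iff)
    qed
  qed simp
  moreover have "1 \<in> ?S" using power2_in_nonzero_squares[of "1::'a"] by simp
  moreover have "(- 1 :: 'a) \<noteq> 1" by (rule minus_neq_self[OF assms]) simp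
  moreover have "card {1, - 1 :: 'a} = 2" using \<open>(- 1 :: 'a) \<noteq> 1\<close> by (metis card_2_iff)
  ultimately show ?thesis
  proof (cases "(- 1 :: 'a) \<in> ?S")
    case True
    have "card ?S = card (?S - {1, - 1}) + card {1, - 1 :: 'a}"
      using True \<open>1 \<in> ?S\<close> by (subst card_Un_disjoint[symmetric]) (auto intro: arg_cong[where f = card])
    then show ?thesis using True \<open>even (card (?S - {1, - 1}))\<close> \<open>card {1, - 1 :: 'a} = 2\<close> by simp
  next
    case False
    then have "?S - {1, - 1} = ?S - {1}" by auto
    then show ?thesis using False \<open>1 \<in> ?S\<close> \<open>even (card (?S - {1, - 1}))\<close>
      using card_Suc_Diff1[of ?S 1] by (metis even_Suc finite)
  qed
qed

text \<open>The squares have index 2 in the multiplicative group: they make up half of it, and multiplication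
  by \<open>n\<close> moves them to a disjoint set of the same size.\<close>

lemma nonsquare_coset:
  fixes n x :: "'a::{field,finite}"
  assumes "(2::'a) \<noteq> 0" "n \<notin> nonzero_squares" "n \<noteq> 0"
    and "x \<notin> nonzero_squares" "x \<noteq> 0"
  obtains d where "d \<noteq> 0" "x = n * d\<^sup>2"
proof -
  let ?S = "nonzero_squares :: 'a set"
  have disj: "?S \<inter> (*) n ` ?S = {}"
  proof (rule ccontr)
    assume "?S \<inter> (*) n ` ?S \<noteq> {}"
    then obtain a b where "a \<noteq> 0" "b \<noteq> 0" "a\<^sup>2 = n * b\<^sup>2" by (auto elim!: nonzero_squaresE)
    then show False using assms(2) nonzero_squares_if_mult_square by metis
  qed
  have "card (?S \<union> (*) n ` ?S) = card ?S + card ?S"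
    using disj \<open>n \<noteq> 0\<close> by (simp add: card_Un_disjoint card_image inj_on_def)
  also have "\<dots> = card (UNIV - {0::'a})"
    using card_nonzero_squares[OF assms(1)] card_Suc_Diff1[of "UNIV :: 'a set" 0] by simp
  finally have "?S \<union> (*) n ` ?S = UNIV - {0}"
    using \<open>n \<noteq> 0\<close> by (intro card_subset_eq) auto
  then have "x \<in> (*) n ` ?S" using assms(4,5) by blast
  then show ?thesis using that by (auto elim!: nonzero_squaresE)
qed

text \<open>Together with 0, the squares make up more than half of the field, so they meet their reflection
  \<open>{a - s | s square}\<close>.\<close>

lemma sum_of_two_squares:
  fixes a :: "'a::{field,finite}"
  assumes "(2::'a) \<noteq> 0"
  obtains y d where "a = y\<^sup>2 + d\<^sup>2"
proof -
  let ?Q = "insert 0 nonzero_squares :: 'a set"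
  have c: "2 * card ?Q = CARD('a) + 1"
    using card_nonzero_squares[OF assms] by simp
  have ci: "card ((-) a ` ?Q) = card ?Q" by (rule card_image) (simp add: inj_on_def)
  have "?Q \<inter> (-) a ` ?Q \<noteq> {}"
  proof
    assume "?Q \<inter> (-) a ` ?Q = {}"
    then have "card (?Q \<union> (-) a ` ?Q) = 2 * card ?Q"
      using ci by (subst card_Un_disjoint) auto
    moreover have "card (?Q \<union> (-) a ` ?Q) \<le> CARD('a)" by (rule card_mono) auto
    ultimately show False using c by simp
  qed
  then obtain u v where "u \<in> ?Q" "v \<in> ?Q" "u = a - v" by blast
  moreover have "\<exists>y. u = y\<^sup>2" if "u \<in> ?Q" for u
    using that by (auto elim: nonzero_squaresE intro: exI[of _ 0])
  ultimately show ?thesis using that by (metis diff_add_cancel)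
qed

text \<open>After division by \<open>- w\<close> the equation says that \<open>- 1 / w = y\<^sup>2 + d\<^sup>2\<close>. Neither summand can vanish,
  since \<open>- 1 / w\<close> is not a square.\<close>

lemma one_plus_multiple_square_nonsquare:
  fixes w :: "'a::{field,finite}"
  assumes "(2::'a) \<noteq> 0" "w \<noteq> 0" "- w \<notin> nonzero_squares"
  obtains d y where "d \<noteq> 0" "y \<noteq> 0" "1 + w * d\<^sup>2 = - w * y\<^sup>2"
proof -
  obtain y d where yd: "- 1 / w = y\<^sup>2 + d\<^sup>2" by (rule sum_of_two_squares[OF assms(1)])
  have ns: "- 1 / w \<noteq> z\<^sup>2" for z
  proof
    assume "- 1 / w = z\<^sup>2"
    then have "- 1 = z\<^sup>2 * w" using assms(2) by (metis nonzero_eq_divide_eq)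
    then have "- w * z\<^sup>2 = 1" by algebra
    moreover from this have "z \<noteq> 0" by auto
    ultimately show False using assms(3) nonzero_squares_if_mult_square[of "- w" z 1] by simp
  qed
  have "d \<noteq> 0" "y \<noteq> 0" using ns[of y] ns[of d] yd by auto
  moreover have "1 + w * d\<^sup>2 = - w * y\<^sup>2"
  proof -
    have "- 1 = w * (y\<^sup>2 + d\<^sup>2)" using yd assms(2) by (metis nonzero_mult_div_cancel_left times_divide_eq_right)
    then show ?thesis by algebra
  qed
  ultimately show ?thesis by (rule that)
qed

text \<open>The lines through \<open>(d, y) = (0, 1)\<close> parametrize the conic \<open>y\<^sup>2 = 1 + w d\<^sup>2\<close>. A slope \<open>- t\<close> yields a
  second point with finite nonzero \<open>d\<close> unless \<open>t = 0\<close> or \<open>t\<^sup>2 = w\<close>, which excludes at most three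
  values of \<open>t\<close>.\<close>

lemma one_plus_multiple_square_square:
  fixes w :: "'a::{field,finite}"
  assumes "(2::'a) \<noteq> 0" "w \<noteq> 0" "- w \<notin> nonzero_squares" "CARD('a) > 3"
  obtains d y where "d \<noteq> 0" "y \<noteq> 0" "1 + w * d\<^sup>2 = y\<^sup>2"
proof -
  have "\<exists>r. {t. t\<^sup>2 = w} \<subseteq> {r, - r}"
  proof (cases "\<exists>r. r\<^sup>2 = w")
    case True
    then obtain r where "r\<^sup>2 = w" ..
    then have "{t. t\<^sup>2 = w} \<subseteq> {r, - r}" by (auto simp: power2_eq_iff)
    then show ?thesis ..
  qed auto
  then obtain r where r: "{t. t\<^sup>2 = w} \<subseteq> {r, - r}" ..
  have "card {0, r, - r} \<le> 3" by (simp add: card_insert_if)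
  then have "{0, r, - r} \<noteq> UNIV" using assms(4) by (metis not_le)
  then obtain t where t: "t \<noteq> 0" "t\<^sup>2 \<noteq> w" using r by blast
  \<comment> \<open>The second intersection of the line \<open>y = 1 - t d\<close> with the conic.\<close>
  define d where "d = 2 * t / (t\<^sup>2 - w)"
  have e: "d * (t\<^sup>2 - w) = 2 * t" using t by (simp add: d_def)
  have "d \<noteq> 0" using t assms(1) by (simp add: d_def)
  have eq: "1 + w * d\<^sup>2 = (1 - t * d)\<^sup>2" using e by algebra
  moreover have "1 - t * d \<noteq> 0"
  proof
    assume "1 - t * d = 0"
    then have "1 + w * d\<^sup>2 = 0" using eq by simp
    then have "- w * d\<^sup>2 = 1" by algebra
    then show False
      using assms(3) \<open>d \<noteq> 0\<close> nonzero_squares_if_mult_square[of "- w" d 1] by simp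
  qed
  ultimately show ?thesis using \<open>d \<noteq> 0\<close> that by blast
qed

section \<open>Products of conjugacy classes\<close>

lemma mem_conj_class:
  assumes "group G" "A \<in> carrier G"
  shows "A \<in> conj_class G A"
proof -
  interpret group G by fact
  show ?thesis
    unfolding conj_class_def using assms(2) by (auto intro!: exI[of _ "\<one>\<^bsub>G\<^esub>"])
qed

text \<open>Conjugating \<open>(g\<inverse> A g) Z\<close> by \<open>g\<inverse>\<close> makes the first factor equal to \<open>A\<close> and keeps the
  second in its class. So only the translate of one class by \<open>A\<close> has to be classified.\<close>

lemma set_mult_conj_class:
  assumes "group G" "A \<in> carrier G" "B \<in> carrier G"
  shows "conj_class G A <#>\<^bsub>G\<^esub> conj_class G B
    = \<Union> (conj_class G ` (\<lambda>Y. A \<otimes>\<^bsub>G\<^esub> Y) ` conj_class G B)"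
proof -
  interpret group G by fact
  have closed: "Y \<in> carrier G" if "Y \<in> conj_class G B" for Y
    using that assms(3) by (auto simp: conj_class_def)
  have conj: "inv\<^bsub>G\<^esub> g \<otimes>\<^bsub>G\<^esub> Y \<otimes>\<^bsub>G\<^esub> g \<in> conj_class G B"
    if "Y \<in> conj_class G B" "g \<in> carrier G" for Y g
    using conj_class_eqI[OF assms(1,3) that(1)] that(2) by (auto simp: conj_class_def)
  have split: "inv\<^bsub>G\<^esub> g \<otimes>\<^bsub>G\<^esub> (A \<otimes>\<^bsub>G\<^esub> Y) \<otimes>\<^bsub>G\<^esub> g
      = (inv\<^bsub>G\<^esub> g \<otimes>\<^bsub>G\<^esub> A \<otimes>\<^bsub>G\<^esub> g) \<otimes>\<^bsub>G\<^esub> (inv\<^bsub>G\<^esub> g \<otimes>\<^bsub>G\<^esub> Y \<otimes>\<^bsub>G\<^esub> g)"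
    if "Y \<in> carrier G" "g \<in> carrier G" for Y g
  proof -
    have "g \<otimes>\<^bsub>G\<^esub> (inv\<^bsub>G\<^esub> g \<otimes>\<^bsub>G\<^esub> (Y \<otimes>\<^bsub>G\<^esub> g)) = Y \<otimes>\<^bsub>G\<^esub> g"
      using that by (simp add: m_assoc[symmetric])
    then show ?thesis using that assms(2) by (simp add: m_assoc)
  qed
  show ?thesis
  proof (intro equalityI subsetI)
    fix X assume "X \<in> conj_class G A <#>\<^bsub>G\<^esub> conj_class G B"
    then obtain g Z where g: "g \<in> carrier G" and Z: "Z \<in> conj_class G B"
      and X: "X = (inv\<^bsub>G\<^esub> g \<otimes>\<^bsub>G\<^esub> A \<otimes>\<^bsub>G\<^esub> g) \<otimes>\<^bsub>G\<^esub> Z"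
      by (auto simp: set_mult_def conj_class_def[of G A])
    define Y where "Y = inv\<^bsub>G\<^esub> (inv\<^bsub>G\<^esub> g) \<otimes>\<^bsub>G\<^esub> Z \<otimes>\<^bsub>G\<^esub> inv\<^bsub>G\<^esub> g"
    have Y: "Y \<in> conj_class G B" unfolding Y_def using Z g by (intro conj) auto
    have "inv\<^bsub>G\<^esub> g \<otimes>\<^bsub>G\<^esub> Y \<otimes>\<^bsub>G\<^esub> g = Z"
    proof -
      have "inv\<^bsub>G\<^esub> g \<otimes>\<^bsub>G\<^esub> (g \<otimes>\<^bsub>G\<^esub> Z) = Z"
        using g closed[OF Z] by (simp add: m_assoc[symmetric])
      then show ?thesis using g closed[OF Z] by (simp add: Y_def m_assoc)
    qed
    then have "X = inv\<^bsub>G\<^esub> g \<otimes>\<^bsub>G\<^esub> (A \<otimes>\<^bsub>G\<^esub> Y) \<otimes>\<^bsub>G\<^esub> g"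
      using X split[OF closed[OF Y] g] by simp
    then have "X \<in> conj_class G (A \<otimes>\<^bsub>G\<^esub> Y)" using g by (auto simp: conj_class_def)
    then show "X \<in> \<Union> (conj_class G ` (\<lambda>Y. A \<otimes>\<^bsub>G\<^esub> Y) ` conj_class G B)" using Y by blast
  next
    fix X assume "X \<in> \<Union> (conj_class G ` (\<lambda>Y. A \<otimes>\<^bsub>G\<^esub> Y) ` conj_class G B)"
    then obtain Y g where Y: "Y \<in> conj_class G B" and g: "g \<in> carrier G"
      and "X = inv\<^bsub>G\<^esub> g \<otimes>\<^bsub>G\<^esub> (A \<otimes>\<^bsub>G\<^esub> Y) \<otimes>\<^bsub>G\<^esub> g"
      by (auto simp: conj_class_def[of G "A \<otimes>\<^bsub>G\<^esub> _"])
    then have "X = (inv\<^bsub>G\<^esub> g \<otimes>\<^bsub>G\<^esub> A \<otimes>\<^bsub>G\<^esub> g) \<otimes>\<^bsub>G\<^esub> (inv\<^bsub>G\<^esub> g \<otimes>\<^bsub>G\<^esub> Y \<otimes>\<^bsub>G\<^esub> g)"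
      using split[OF closed[OF Y] g] by simp
    moreover have "inv\<^bsub>G\<^esub> g \<otimes>\<^bsub>G\<^esub> A \<otimes>\<^bsub>G\<^esub> g \<in> conj_class G A"
      using g by (auto simp: conj_class_def)
    ultimately show "X \<in> conj_class G A <#>\<^bsub>G\<^esub> conj_class G B"
      using conj[OF Y g] by (auto simp: set_mult_def)
  qed
qed

section \<open>Conjugation in SL(2)\<close>

definition mat2 :: "'a \<Rightarrow> 'a \<Rightarrow> 'a \<Rightarrow> 'a \<Rightarrow> 'a::field ^ 2 ^ 2" where
  "mat2 a b c d = vector [vector [a, b], vector [c, d]]"

lemma mat2_nth [simp]:
  "mat2 a b c d $ 1 $ 1 = a" "mat2 a b c d $ 1 $ 2 = b"
  "mat2 a b c d $ 2 $ 1 = c" "mat2 a b c d $ 2 $ 2 = d"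
  by (simp_all add: mat2_def)

lemma mat2_eq_iff [simp]:
  "mat2 a b c d = mat2 a' b' c' d' \<longleftrightarrow> a = a' \<and> b = b' \<and> c = c' \<and> d = d'"
  by (metis mat2_nth)

lemma mat2_exhaust:
  obtains a b c d where "X = mat2 a b c d"
proof
  show "X = mat2 (X $ 1 $ 1) (X $ 1 $ 2) (X $ 2 $ 1) (X $ 2 $ 2)"
    by (simp add: vec_eq_iff forall_2)
qed

lemma mat2_mult:
  "mat2 a b c d ** mat2 a' b' c' d'
    = mat2 (a * a' + b * c') (a * b' + b * d') (c * a' + d * c') (c * b' + d * d')"
  by (simp add: vec_eq_iff forall_2 matrix_matrix_mult_def sum_2)

lemma mat_1_eq_mat2: "mat 1 = mat2 1 0 0 1"
  by (simp add: vec_eq_iff forall_2 mat_def)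

lemma trace_mat2: "trace (mat2 a b c d) = a + d"
  by (simp add: trace_def sum_2)

lemma upper_unitri_eq_mat2: "upper_unitri t = mat2 1 t 0 1"
  by (simp add: upper_unitri_def mat2_def)

lemma mat2_in_SL2 [simp]: "mat2 a b c d \<in> carrier SL2 \<longleftrightarrow> a * d - b * c = 1"
  by (simp add: SL2_def det_2)

lemma mult_SL2 [simp]: "X \<otimes>\<^bsub>SL2\<^esub> Y = X ** Y"
  by (simp add: SL2_def)

lemma inv_mat2_SL2:
  assumes "a * d - b * c = 1"
  shows "inv\<^bsub>SL2\<^esub> (mat2 a b c d) = mat2 d (- b) (- c) a"
proof (rule group.inv_equality[OF group_SL2])
  show "mat2 d (- b) (- c) a \<otimes>\<^bsub>SL2\<^esub> mat2 a b c d = \<one>\<^bsub>SL2\<^esub>"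
    using assms by (simp add: mat2_mult mat_1_eq_mat2 SL2_def algebra_simps)
qed (use assms in \<open>simp_all add: algebra_simps\<close>)

text \<open>The inverse of a matrix of determinant 1 is its adjugate, which makes conjugation polynomial.\<close>

lemma mem_conj_class_SL2_iff:
  "X \<in> conj_class SL2 A \<longleftrightarrow>
    (\<exists>a b c d. a * d - b * c = 1 \<and> X = mat2 d (- b) (- c) a ** A ** mat2 a b c d)"
proof
  assume "X \<in> conj_class SL2 A"
  then obtain B where B: "B \<in> carrier SL2" "X = inv\<^bsub>SL2\<^esub> B ** A ** B"
    by (auto simp: conj_class_def)
  obtain a b c d where "B = mat2 a b c d" by (rule mat2_exhaust)
  with B show "\<exists>a b c d. a * d - b * c = 1 \<and> X = mat2 d (- b) (- c) a ** A ** mat2 a b c d"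
    by (metis inv_mat2_SL2 mat2_in_SL2)
next
  assume "\<exists>a b c d. a * d - b * c = 1 \<and> X = mat2 d (- b) (- c) a ** A ** mat2 a b c d"
  then show "X \<in> conj_class SL2 A"
    unfolding conj_class_def by (metis (mono_tags, lifting) CollectI inv_mat2_SL2 mat2_in_SL2 mult_SL2)
qed

lemma trace_conj_class_SL2:
  assumes "X \<in> conj_class SL2 A"
  shows "trace X = trace A"
proof -
  obtain a b c d where det: "a * d - b * c = 1"
    and X: "X = mat2 d (- b) (- c) a ** A ** mat2 a b c d"
    using assms by (auto simp: mem_conj_class_SL2_iff)
  have "trace X = trace (mat2 a b c d ** (mat2 d (- b) (- c) a ** A))"
    unfolding X by (rule trace_mul_sym)
  also have "mat2 a b c d ** (mat2 d (- b) (- c) a ** A) = (mat 1 :: 'a ^ 2 ^ 2) ** A"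
    using det by (simp add: matrix_mul_assoc mat2_mult mat_1_eq_mat2 algebra_simps)
  finally show ?thesis by simp
qed

text \<open>Since \<open>U(t) = 1 + t E\<^sub>1\<^sub>2\<close>, its conjugate depends only on the first column \<open>(d, - c)\<close> of the inverse
  of the conjugating matrix and on the second row \<open>(c, d)\<close> of that matrix; every nonzero row occurs.\<close>

lemma conj_class_upper_unitri:
  "conj_class SL2 (upper_unitri t)
    = {mat2 (1 + t * (c * d)) (t * d\<^sup>2) (- t * c\<^sup>2) (1 - t * (c * d)) |c d. c \<noteq> 0 \<or> d \<noteq> 0}"
proof -
  have *: "mat2 d (- b) (- c) a ** upper_unitri t ** mat2 a b c d
      = mat2 (1 + t * (c * d)) (t * d\<^sup>2) (- t * c\<^sup>2) (1 - t * (c * d))"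
    if "a * d - b * c = 1" for a b c d
    unfolding upper_unitri_eq_mat2 mat2_mult mat2_eq_iff
    using that by (auto simp: algebra_simps power2_eq_square)
  have ex: "\<exists>a b. a * d - b * c = 1" if "c \<noteq> 0 \<or> d \<noteq> 0" for c d :: 'a
  proof (cases "d = 0")
    case True
    then have "0 * d - (- 1 / c) * c = 1" using that by simp
    then show ?thesis by blast
  next
    case False
    then have "(1 / d) * d - 0 * c = 1" by simp
    then show ?thesis by blast
  qed
  show ?thesis
  proof (intro equalityI subsetI)
    fix X assume "X \<in> conj_class SL2 (upper_unitri t)"
    then obtain a b c d where det: "a * d - b * c = 1"
      and X: "X = mat2 d (- b) (- c) a ** upper_unitri t ** mat2 a b c d"
      by (auto simp: mem_conj_class_SL2_iff)
    have "c \<noteq> 0 \<or> d \<noteq> 0" using det by auto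
    then show "X \<in> {mat2 (1 + t * (c * d)) (t * d\<^sup>2) (- t * c\<^sup>2) (1 - t * (c * d)) |c d.
        c \<noteq> 0 \<or> d \<noteq> 0}"
      using X *[OF det] by blast
  next
    fix X assume "X \<in> {mat2 (1 + t * (c * d)) (t * d\<^sup>2) (- t * c\<^sup>2) (1 - t * (c * d)) |c d.
        c \<noteq> 0 \<or> d \<noteq> 0}"
    then obtain c d where "c \<noteq> 0 \<or> d \<noteq> 0"
      and X: "X = mat2 (1 + t * (c * d)) (t * d\<^sup>2) (- t * c\<^sup>2) (1 - t * (c * d))"
      by blast
    then obtain a b where det: "a * d - b * c = 1" using ex by blast
    show "X \<in> conj_class SL2 (upper_unitri t)"
      unfolding mem_conj_class_SL2_iff X using *[OF det] det by metis
  qed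
qed

text \<open>Conjugation by a diagonal matrix scales the off-diagonal entry by a square.\<close>

lemma conj_class_upper_unitri_mult_square:
  assumes "d \<noteq> 0"
  shows "conj_class SL2 (upper_unitri (t * d\<^sup>2)) = conj_class SL2 (upper_unitri t)"
proof (rule conj_class_eqI[OF group_SL2 upper_unitri_in_SL2])
  show "upper_unitri (t * d\<^sup>2) \<in> conj_class SL2 (upper_unitri t)"
    unfolding conj_class_upper_unitri unfolding upper_unitri_eq_mat2
    using assms by (intro CollectI exI[of _ 0] exI[of _ d]) simp
qed

text \<open>When the lower left entry is nonzero, conjugation by \<open>U(x)\<close> keeps that entry and can clear the upper
  left one. The trace and the determinant then determine the remaining two entries.\<close>

lemma conj_class_eq_companion:
  assumes "a * d - b * c = 1" "c \<noteq> 0"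
  shows "conj_class SL2 (mat2 a b c d) = conj_class SL2 (mat2 0 (- 1 / c) c (a + d))"
proof (rule conj_class_eqI[OF group_SL2, symmetric])
  \<comment> \<open>Conjugation by \<open>U(x)\<close> changes the upper left entry to \<open>a - x c\<close>.\<close>
  define x where "x = a / c"
  have x: "c * x = a" using assms(2) by (simp add: x_def)
  have u: "c * (- 1 / c) = - 1" using assms(2) by simp
  have "c * (- 1 / c) = c * (a * x + b - x * (c * x + d))"
    unfolding u using assms(1) x by algebra
  then have "- 1 / c = a * x + b - x * (c * x + d)" using assms(2) mult_left_cancel by blast
  then have "mat2 0 (- 1 / c) c (a + d) = mat2 1 (- x) (- 0) 1 ** mat2 a b c d ** mat2 1 x 0 1"
    using x by (simp add: mat2_mult algebra_simps)
  then show "mat2 0 (- 1 / c) c (a + d) \<in> conj_class SL2 (mat2 a b c d)"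
    unfolding mem_conj_class_SL2_iff by (intro exI[of _ 1] exI[of _ x] exI[of _ 0]) auto
qed (use assms in simp)

lemma upper_unitri_noncentral:
  assumes "t \<noteq> 0"
  shows "upper_unitri t \<in> carrier SL2 - group_center SL2"
proof -
  have "upper_unitri t ** mat2 1 0 1 1 \<noteq> mat2 1 0 1 1 ** upper_unitri t"
    using assms by (simp add: upper_unitri_eq_mat2 mat2_mult)
  moreover have "mat2 1 0 1 1 \<in> (carrier SL2 :: ('a ^ 2 ^ 2) set)" by simp
  ultimately show ?thesis
    using upper_unitri_in_SL2[of t] unfolding group_center_def by auto
qed

section \<open>The product of two unipotent classes\<close>

text \<open>The normal form of a matrix of determinant 1 with lower left entry \<open>t \<noteq> 0\<close> and trace \<open>2 + t\<close>. All
  products \<open>U(1) Y\<close> with \<open>Y\<close> conjugate to some \<open>U(w)\<close> satisfy this relation between entry and trace.\<close>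

definition companion :: "'a \<Rightarrow> 'a::field ^ 2 ^ 2" where
  "companion t = mat2 0 (- 1 / t) t (2 + t)"

lemma companion_in_SL2: "t \<noteq> 0 \<Longrightarrow> companion t \<in> carrier SL2"
  by (simp add: companion_def)

text \<open>The two parts on the right correspond to conjugating matrices whose second row \<open>(c, d)\<close> has \<open>c = 0\<close>
  and \<open>c \<noteq> 0\<close> respectively.\<close>

lemma upper_unitri_translate_classes:
  fixes w :: "'a::field"
  assumes "w \<noteq> 0"
  shows "conj_class SL2 ` (\<lambda>Y. upper_unitri 1 \<otimes>\<^bsub>SL2\<^esub> Y) ` conj_class SL2 (upper_unitri w)
    = (\<lambda>d. conj_class SL2 (upper_unitri (1 + w * d\<^sup>2))) ` (UNIV - {0})
      \<union> (\<lambda>s. conj_class SL2 (companion (- w * s))) ` nonzero_squares"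
    (is "?L = ?U \<union> ?C")
proof -
  let ?Y = "\<lambda>c d. mat2 (1 + w * (c * d)) (w * d\<^sup>2) (- w * c\<^sup>2) (1 - w * (c * d))"
  have L: "?L = {conj_class SL2 (upper_unitri 1 ** ?Y c d) |c d. c \<noteq> 0 \<or> d \<noteq> 0}"
    unfolding conj_class_upper_unitri mult_SL2 by blast
  have zero: "upper_unitri 1 ** ?Y 0 d = upper_unitri (1 + w * d\<^sup>2)" for d
    by (simp add: upper_unitri_eq_mat2 mat2_mult algebra_simps)
  have nonzero: "conj_class SL2 (upper_unitri 1 ** ?Y c d) = conj_class SL2 (companion (- w * c\<^sup>2))"
    if "c \<noteq> 0" for c d
  proof -
    let ?a = "1 + w * (c * d) - w * c\<^sup>2" and ?b = "w * d\<^sup>2 + 1 - w * (c * d)"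
      and ?c = "- w * c\<^sup>2" and ?d = "1 - w * (c * d)"
    have prod: "upper_unitri 1 ** ?Y c d = mat2 ?a ?b ?c ?d"
      by (simp add: upper_unitri_eq_mat2 mat2_mult)
    have det: "?a * ?d - ?b * ?c = 1" by algebra
    have "?c \<noteq> 0" using assms that by simp
    moreover have "?a + ?d = 2 + ?c" by simp
    ultimately show ?thesis
      unfolding prod companion_def using conj_class_eq_companion[OF det] by simp
  qed
  show ?thesis
  proof (intro equalityI subsetI)
    fix X assume "X \<in> ?L"
    then obtain c d where cd: "c \<noteq> 0 \<or> d \<noteq> 0" and X: "X = conj_class SL2 (upper_unitri 1 ** ?Y c d)"
      unfolding L by blast
    show "X \<in> ?U \<union> ?C"
    proof (cases "c = 0")
      case True
      have "X = conj_class SL2 (upper_unitri (1 + w * d\<^sup>2))"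
        unfolding X True zero ..
      then show ?thesis using cd True by blast
    next
      case False
      then have "c\<^sup>2 \<in> nonzero_squares" by simp
      then show ?thesis unfolding X nonzero[OF False] by blast
    qed
  next
    fix X assume "X \<in> ?U \<union> ?C"
    then show "X \<in> ?L"
    proof
      assume "X \<in> ?U"
      then obtain d where "d \<noteq> 0" "X = conj_class SL2 (upper_unitri (1 + w * d\<^sup>2))" by blast
      then show ?thesis unfolding L zero[symmetric] by blast
    next
      assume "X \<in> ?C"
      then obtain c where "c \<noteq> 0" "X = conj_class SL2 (companion (- w * c\<^sup>2))"
        by (auto elim!: nonzero_squaresE)
      then show ?thesis unfolding L using nonzero[of c 0] by blast
    qed
  qed
qed

text \<open>As \<open>d\<close> varies, \<open>1 + w d\<^sup>2\<close> avoids 0 and meets both cosets of the nonzero squares, for which \<open>1\<close> and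
  \<open>- w\<close> serve as representatives.\<close>

lemma unipotent_part:
  fixes w :: "'a::{field,finite}"
  assumes "(2::'a) \<noteq> 0" "w \<noteq> 0" "- w \<notin> nonzero_squares" "CARD('a) > 3"
  shows "(\<lambda>d. conj_class SL2 (upper_unitri (1 + w * d\<^sup>2))) ` (UNIV - {0})
    = {conj_class SL2 (upper_unitri 1), conj_class SL2 (upper_unitri (- w))}"
    (is "?f ` _ = {?P, ?N}")
proof (intro equalityI subsetI)
  fix X assume "X \<in> ?f ` (UNIV - {0})"
  then obtain d where d: "d \<noteq> 0" "X = ?f d" by blast
  have "1 + w * d\<^sup>2 \<noteq> 0"
  proof
    assume "1 + w * d\<^sup>2 = 0"
    then have "- w * d\<^sup>2 = 1" by algebra
    then show False using assms(3) d(1) nonzero_squares_if_mult_square[of "- w" d 1] by simp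
  qed
  moreover have "X = ?P" if square: "1 + w * d\<^sup>2 \<in> nonzero_squares"
  proof -
    obtain y where "y \<noteq> 0" "1 + w * d\<^sup>2 = 1 * y\<^sup>2" using square by (auto elim: nonzero_squaresE)
    then show ?thesis using d(2) conj_class_upper_unitri_mult_square by metis
  qed
  moreover have "X = ?N" if nonsquare: "1 + w * d\<^sup>2 \<notin> nonzero_squares" "1 + w * d\<^sup>2 \<noteq> 0"
  proof -
    obtain y where "y \<noteq> 0" "1 + w * d\<^sup>2 = - w * y\<^sup>2"
      using nonsquare_coset[OF assms(1,3) _ nonsquare] assms(2) by auto
    then show ?thesis using d(2) conj_class_upper_unitri_mult_square by metis
  qed
  ultimately show "X \<in> {?P, ?N}" by blast
next
  fix X assume "X \<in> {?P, ?N}"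
  then consider "X = ?P" | "X = ?N" by blast
  then show "X \<in> ?f ` (UNIV - {0})"
  proof cases
    case 1
    obtain d y where "d \<noteq> 0" "y \<noteq> 0" "1 + w * d\<^sup>2 = 1 * y\<^sup>2"
      using one_plus_multiple_square_square[OF assms] by auto
    then have "?f d = X" unfolding 1 by (metis conj_class_upper_unitri_mult_square)
    then show ?thesis using \<open>d \<noteq> 0\<close> by blast
  next
    case 2
    obtain d y where "d \<noteq> 0" "y \<noteq> 0" "1 + w * d\<^sup>2 = - w * y\<^sup>2"
      using one_plus_multiple_square_nonsquare[OF assms(1-3)] by auto
    then have "?f d = X" unfolding 2 by (metis conj_class_upper_unitri_mult_square)
    then show ?thesis using \<open>d \<noteq> 0\<close> by blast
  qed
qed

lemma conj_class_eqD_trace: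
  assumes "conj_class SL2 A = conj_class SL2 B" "A \<in> carrier SL2"
  shows "trace A = trace B"
  using assms trace_conj_class_SL2 mem_conj_class[OF group_SL2] by metis

text \<open>It remains to see that the classes found are distinct. The trace separates the companion classes from
  each other and from the unipotent ones; the classes of \<open>U(1)\<close> and \<open>U(- w)\<close> differ because an upper
  triangular conjugate of \<open>U(1)\<close> has a square as its off-diagonal entry.\<close>

lemma product_of_unipotent_classes:
  fixes w :: "'a::{field,finite}"
  assumes "odd CARD('a)" "CARD('a) > 3" "w \<noteq> 0" "- w \<notin> nonzero_squares"
  obtains K where "K \<subseteq> conj_classes SL2"
    and "conj_class SL2 (upper_unitri 1) <#>\<^bsub>SL2\<^esub> conj_class SL2 (upper_unitri w) = \<Union>K"
    and "card K = (CARD('a) + 3) div 2"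
proof -
  let ?cls = "conj_class (SL2 :: ('a ^ 2 ^ 2) monoid)"
  let ?S = "nonzero_squares :: 'a set"
  define C where "C = (\<lambda>s. ?cls (companion (- w * s))) ` ?S"
  define K where "K = {?cls (upper_unitri 1), ?cls (upper_unitri (- w))} \<union> C"
  have two: "(2::'a) \<noteq> 0" by (rule two_neq_zero_if_odd_card[OF assms(1)])
  have S_nz: "- w * s \<noteq> 0" if "s \<in> ?S" for s
    using that assms(3) by (auto elim: nonzero_squaresE)
  have trace_U: "trace (upper_unitri t) = 2" for t :: 'a
    by (simp add: upper_unitri_eq_mat2 trace_mat2)
  have trace_C: "trace (companion t) = 2 + t" for t :: 'a
    by (simp add: companion_def trace_mat2)
  have "inj_on (\<lambda>s. ?cls (companion (- w * s))) ?S"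
  proof (rule inj_onI)
    fix s t assume "s \<in> ?S" "t \<in> ?S" "?cls (companion (- w * s)) = ?cls (companion (- w * t))"
    then have "trace (companion (- w * s)) = trace (companion (- w * t))"
      by (intro conj_class_eqD_trace companion_in_SL2 S_nz)
    then show "s = t" using assms(3) by (simp add: trace_C)
  qed
  then have "card C = card ?S" unfolding C_def by (rule card_image)
  moreover have "?cls (upper_unitri t) \<notin> C" for t
  proof
    assume "?cls (upper_unitri t) \<in> C"
    then obtain s where "s \<in> ?S" "?cls (upper_unitri t) = ?cls (companion (- w * s))"
      by (auto simp: C_def)
    then have "trace (companion (- w * s)) = 2"
      using conj_class_eqD_trace[OF _ upper_unitri_in_SL2] trace_U by metis
    then show False using S_nz[OF \<open>s \<in> ?S\<close>] by (simp add: trace_C)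
  qed
  moreover have "?cls (upper_unitri 1) \<noteq> ?cls (upper_unitri (- w))"
  proof
    assume "?cls (upper_unitri 1) = ?cls (upper_unitri (- w))"
    then have "upper_unitri (- w) \<in> ?cls (upper_unitri 1)"
      using mem_conj_class[OF group_SL2 upper_unitri_in_SL2] by metis
    then obtain c d :: 'a where "c \<noteq> 0 \<or> d \<noteq> 0" "c\<^sup>2 = 0" "- w = d\<^sup>2"
      unfolding conj_class_upper_unitri unfolding upper_unitri_eq_mat2 by auto
    then show False using assms(4) by simp
  qed
  moreover have "finite C" by simp
  ultimately have "card K = 2 + card ?S" unfolding K_def by simp
  then have "card K = (CARD('a) + 3) div 2"
    using card_nonzero_squares[OF two] by simp
  moreover have "?cls (upper_unitri 1) <#>\<^bsub>SL2\<^esub> ?cls (upper_unitri w) = \<Union>K"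
    unfolding set_mult_conj_class[OF group_SL2 upper_unitri_in_SL2 upper_unitri_in_SL2]
      upper_unitri_translate_classes[OF assms(3)] unipotent_part[OF two assms(3,4,2)]
    by (simp only: K_def C_def)
  moreover have "K \<subseteq> conj_classes SL2"
    unfolding K_def C_def conj_classes_def
    by (blast intro: upper_unitri_in_SL2 companion_in_SL2[OF S_nz])
  ultimately show ?thesis using that by blast
qed

theorem proposition2p20:
  fixes q :: nat and S :: "('a::{field,finite} ^ 2 ^ 2) monoid"
  assumes "CARD('a) = q" and "q > 3" and "odd q"
    and "S = SL2"
  shows "(q mod 4 = 1 \<longrightarrow>
            (\<forall>w::'a. w \<in> UNIV - {x^2 |x. True} \<longrightarrow>
               (let A = upper_unitri 1; B = upper_unitri w in
                 eta S (conj_class S A <#>\<^bsub>S\<^esub> conj_class S B) = (q + 3) div 2)))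
       \<and> (q mod 4 \<noteq> 1 \<longrightarrow>
            (let E = upper_unitri 1 in
              eta S (conj_class S E <#>\<^bsub>S\<^esub> conj_class S E) = (q + 3) div 2))
       \<and> (\<exists>X \<in> carrier S - group_center S. \<exists>Y \<in> carrier S - group_center S.
            \<exists>K \<subseteq> conj_classes S.
              conj_class S X <#>\<^bsub>S\<^esub> conj_class S Y = \<Union>K \<and> card K = (q + 3) div 2)"
proof -
  let ?Q = "nonzero_squares :: 'a set"
  have two: "(2::'a) \<noteq> 0" using two_neq_zero_if_odd_card assms(1,3) by metis
  have card_Q: "2 * card ?Q + 1 = q" using card_nonzero_squares[OF two] assms(1) by simp
  have product: "\<exists>K \<subseteq> conj_classes S.
      conj_class S (upper_unitri 1) <#>\<^bsub>S\<^esub> conj_class S (upper_unitri w) = \<Union>K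
      \<and> card K = (q + 3) div 2"
    if w: "w \<noteq> 0" "- w \<notin> nonzero_squares" for w :: 'a
    using product_of_unipotent_classes[OF _ _ w] assms by metis
  have eta: "eta S (conj_class S (upper_unitri 1) <#>\<^bsub>S\<^esub> conj_class S (upper_unitri w))
      = (q + 3) div 2" if "w \<noteq> 0" "- w \<notin> nonzero_squares" for w :: 'a
    using product[OF that] eta_Union[of S] group_SL2 assms(4) by metis
  have minus_nonsquare: "- w \<notin> ?Q" if "q mod 4 = 1" "w \<notin> ?Q" for w
  proof
    assume "- w \<in> ?Q"
    have "even (card ?Q)" using card_Q that(1) by presburger
    then have "- 1 \<in> ?Q" using minus_one_square_iff[OF two] by simp
    then obtain i :: 'a where "i \<noteq> 0" "- 1 = i\<^sup>2" by (rule nonzero_squaresE)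
    moreover obtain d where "d \<noteq> 0" "- w = d\<^sup>2" using \<open>- w \<in> ?Q\<close> by (rule nonzero_squaresE)
    ultimately have "i * d \<noteq> 0" "w = (i * d)\<^sup>2" by (simp, algebra)
    then show False using that(2) by simp
  qed
  have minus_one: "- 1 \<notin> ?Q" if "q mod 4 \<noteq> 1"
  proof -
    have "odd (card ?Q)" using card_Q that by presburger
    then show ?thesis using minus_one_square_iff[OF two] by simp
  qed
  have "\<exists>w. w \<noteq> 0 \<and> - w \<notin> ?Q"
  proof -
    have "insert 0 ?Q \<noteq> UNIV"
    proof
      assume "insert 0 ?Q = UNIV"
      then have "q = Suc (card ?Q)"
        using assms(1) by (metis card_insert_disjoint finite zero_notin_nonzero_squares)
      then show False using card_Q assms(2) by simp
    qed
    then obtain n where "n \<noteq> 0" "n \<notin> ?Q" by blast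
    then show ?thesis by (intro exI[of _ "- n"]) simp
  qed
  then obtain w :: 'a where w: "w \<noteq> 0" "- w \<notin> ?Q" by blast
  have "upper_unitri t \<in> carrier S - group_center S" if "t \<noteq> 0" for t :: 'a
    using upper_unitri_noncentral[OF that] assms(4) by simp
  then have "\<exists>X \<in> carrier S - group_center S. \<exists>Y \<in> carrier S - group_center S.
      \<exists>K \<subseteq> conj_classes S.
        conj_class S X <#>\<^bsub>S\<^esub> conj_class S Y = \<Union>K \<and> card K = (q + 3) div 2"
    using product[OF w] w(1) one_neq_zero by blast
  moreover have "eta S (conj_class S (upper_unitri 1) <#>\<^bsub>S\<^esub> conj_class S (upper_unitri w))
      = (q + 3) div 2" if "q mod 4 = 1" "w \<in> UNIV - {x\<^sup>2 |x. True}" for w :: 'a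
  proof (rule eta)
    show "w \<noteq> 0" using that(2) by (auto dest: spec[of _ 0])
    show "- w \<notin> ?Q" using that by (intro minus_nonsquare) (auto simp: nonzero_squares_def)
  qed
  moreover have "eta S (conj_class S (upper_unitri 1) <#>\<^bsub>S\<^esub> conj_class S (upper_unitri 1))
      = (q + 3) div 2" if "q mod 4 \<noteq> 1"
    using minus_one[OF that] by (intro eta) simp_all
  ultimately show ?thesis by (simp only: Let_def simp_thms) blast
qed

end
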